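(* Let $V$ be a euclidean space of dimension $n\ge2$, let $c(t)$ be a regular curve in $V$ and let $\kappa_1(t),\dots,\kappa_{n-1}(t)$ be its curvatures. Then for $1\le r\le n-2$, $$\kappa_r=\frac{\|c'\times\cdots\times c^{(r-1)}\|\,\|c'\times\cdots\times c^{(r+1)}\|}{\|c'\times\cdots\times c^{(r)}\|^2}\,\|c'\|^{-1}.$$ For the torsion, $$\kappa_{n-1}=\frac{\|c'\times\cdots\times c^{(n-2)}\|}{\|c'\times\cdots\times c^{(n-1)}\|^2}\,\det\left(c',c'',\dots,c^{(n)}\right)\|c'\|^{-1}.$$
   Context: A euclidean space is a finite-dimensional, oriented, real vector space $V$ with a positive definite scalar product $\langle\cdot,\cdot\rangle$. A regular curve in $V$ ($\dim V=n$) is a map $c:[a,b]\to V$, $a<b$, which is differentiable as many times as needed and such that $c'(t),\dots,c^{(n-1)}(t)$ are linearly independent for every $t\in[a,b]$. The exterior algebra $\bigwedge V=\bigoplus_{k=0}^n\wedge^kV$ carries the scalar product for which different degrees are orthogonal and $\langle u_1\wedge\cdots\wedge u_k,v_1\wedge\cdots\wedge v_k\rangle=\det(\langle u_i,v_j\rangle)$; norms of elements of $\wedge^kV$ are with respect to it. Let $o\in\wedge^nV$ be the unit vector $e_1\wedge\cdots\wedge e_n$ for any positive orthonormal basis. The multiple cross product of $v_1,\dots,v_k\in V$, $1\le k\le n$, is the element $v_1\times\cdots\times v_k\in\wedge^{n-k}V$ characterized by $\langle v_1\times\cdots\times v_k,w\rangle=\langle o,v_1\wedge\cdots\wedge v_k\wedge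 w\rangle$ for all $w\in\bigwedge V$. By convention the norm of the empty cross product (when $r=1$, resp. $n=2$) is $1$. $\det(v_1,\dots,v_n)$ is the determinant of the coordinate matrix of $v_1,\dots,v_n$ in any positive orthonormal basis. Frenet-Serret frame $e(t)=(e_1(t),\dots,e_n(t))$: $e_1,\dots,e_{n-1}$ is the Gram-Schmidt orthonormalization of $c',\dots,c^{(n-1)}$ (so $e_i$ is a linear combination of $c',\dots,c^{(i)}$ with positive coefficient at $c^{(i)}$), and $e_n$ is the unique vector making $e_1,\dots,e_n$ a positive orthonormal basis. The curvatures $\kappa_1,\dots,\kappa_{n-1}$ are determined by $e_i'=\|c'\|\,(-\kappa_{i-1}e_{i-1}+\kappa_i e_{i+1})$, $1\le i\le n$ (terms involving $e_0$ or $e_{n+1}$ are absent). The torsion is $\kappa_{n-1}$. *)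

theory Defs
  imports "HOL-Analysis.Derivative" "HOL-Library.Countable_Set" "Jordan_Normal_Form.Determinant"
begin

no_notation Matrix.scalar_prod (infix \<open>\<bullet>\<close> 70)

section \<open>The exterior algebra of a euclidean space\<close>

text \<open>
  An element of the exterior algebra of a space \<open>'a\<close> is given by its coefficients with respect to
  the monomials \<open>b\<^sub>1 \<and> \<dots> \<and> b\<^sub>k\<close>, where \<open>b\<^sub>1 < \<dots> < b\<^sub>k\<close> are elements of \<^term>\<open>Basis\<close> in an
  auxiliary linear order (given by \<^term>\<open>to_nat_on Basis\<close>); the monomial is indexed by the set \<open>{b\<^sub>1, \<dots>, b\<^sub>k}\<close>.
  That this is the exterior algebra with its usual scalar product is the content of the facts
  \<open>ext_vec_square\<close>, \<open>span_ext_wedge\<close>, \<open>inner_ext_wedge\<close> and \<open>inner_ext_wedge_degree\<close> below.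
\<close>

typedef (overloaded) 'a exterior =
  "{f :: 'a::euclidean_space set \<Rightarrow> real. \<forall>S. \<not> S \<subseteq> Basis \<longrightarrow> f S = 0}"
  morphisms ext_coeff Abs_exterior
  by (rule exI[of _ "\<lambda>_. 0"]) simp

setup_lifting type_definition_exterior

lemma exterior_eqI:
  assumes "\<And>S. S \<subseteq> Basis \<Longrightarrow> ext_coeff x S = ext_coeff y S"
  shows "x = y"
  using assms by transfer (metis ext)

instantiation exterior :: (euclidean_space) real_vector
begin

lift_definition zero_exterior :: "'a exterior" is "\<lambda>_. 0" by simp
lift_definition plus_exterior :: "'a exterior \<Rightarrow> 'a exterior \<Rightarrow> 'a exterior"
  is "\<lambda>f g S. f S + g S" by simp
lift_definition minus_exterior :: "'a exterior \<Rightarrow> 'a exterior \<Rightarrow> 'a exterior"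
  is "\<lambda>f g S. f S - g S" by simp
lift_definition uminus_exterior :: "'a exterior \<Rightarrow> 'a exterior"
  is "\<lambda>f S. - f S" by simp
lift_definition scaleR_exterior :: "real \<Rightarrow> 'a exterior \<Rightarrow> 'a exterior"
  is "\<lambda>r f S. r * f S" by simp

instance
  by standard (transfer, simp add: fun_eq_iff algebra_simps)+

end

lemmas ext_coeff_simps [simp] =
  zero_exterior.rep_eq plus_exterior.rep_eq minus_exterior.rep_eq
  uminus_exterior.rep_eq scaleR_exterior.rep_eq

lemma ext_coeff_sum [simp]: "ext_coeff (sum f A) S = (\<Sum>x\<in>A. ext_coeff (f x) S)"
  by (induction A rule: infinite_finite_induct) auto

lift_definition ext_monom :: "'a::euclidean_space set \<Rightarrow> 'a exterior"
  is "\<lambda>T S. if S = T \<and> S \<subseteq> Basis then 1 else 0" by simp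

instantiation exterior :: (euclidean_space) euclidean_space
begin

definition inner_exterior :: "'a exterior \<Rightarrow> 'a exterior \<Rightarrow> real"
  where "inner_exterior x y = (\<Sum>S\<in>Pow Basis. ext_coeff x S * ext_coeff y S)"
definition norm_exterior :: "'a exterior \<Rightarrow> real"
  where "norm_exterior x = sqrt (x \<bullet> x)"
definition sgn_exterior :: "'a exterior \<Rightarrow> 'a exterior"
  where "sgn_exterior x = x /\<^sub>R norm x"
definition dist_exterior :: "'a exterior \<Rightarrow> 'a exterior \<Rightarrow> real"
  where "dist_exterior x y = norm (x - y)"
definition uniformity_exterior :: "('a exterior \<times> 'a exterior) filter"
  where "uniformity_exterior = (INF e\<in>{0 <..}. principal {(x, y). dist x y < e})"
definition open_exterior :: "'a exterior set \<Rightarrow> bool"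
  where "open_exterior U \<longleftrightarrow> (\<forall>x\<in>U. eventually (\<lambda>(x', y). x' = x \<longrightarrow> y \<in> U) uniformity)"
definition Basis_exterior :: "'a exterior set"
  where "Basis_exterior = ext_monom ` Pow Basis"

lemma inner_ext_monom:
  assumes "S \<subseteq> Basis"
  shows "x \<bullet> ext_monom S = ext_coeff x S"
proof -
  have "x \<bullet> ext_monom S = (\<Sum>T\<in>Pow Basis. if T = S then ext_coeff x T else 0)"
    unfolding inner_exterior_def by (intro sum.cong) (auto simp: ext_monom.rep_eq)
  then show ?thesis using assms by simp
qed

instance
proof
  fix x y z :: "'a exterior" and r :: real
  show "x \<bullet> y = y \<bullet> x"
    by (simp add: inner_exterior_def mult.commute)
  show "(x + y) \<bullet> z = x \<bullet> z + y \<bullet> z"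
    by (simp add: inner_exterior_def algebra_simps sum.distrib)
  show "(r *\<^sub>R x) \<bullet> y = r * (x \<bullet> y)"
    by (simp add: inner_exterior_def sum_distrib_left mult.assoc)
  show "0 \<le> x \<bullet> x"
    by (simp add: inner_exterior_def sum_nonneg)
  show "x \<bullet> x = 0 \<longleftrightarrow> x = 0"
  proof
    assume "x \<bullet> x = 0"
    then have "\<forall>S\<in>Pow Basis. ext_coeff x S * ext_coeff x S = 0"
      unfolding inner_exterior_def by (subst (asm) sum_nonneg_eq_0_iff) auto
    then show "x = 0" by (intro exterior_eqI) auto
  qed (simp add: inner_exterior_def)
  show "norm x = sqrt (x \<bullet> x)" by (fact norm_exterior_def)
  show "sgn x = x /\<^sub>R norm x" by (fact sgn_exterior_def)
  show "dist x y = norm (x - y)" by (fact dist_exterior_def)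
  show "(uniformity :: ('a exterior \<times> 'a exterior) filter)
      = (INF e\<in>{0 <..}. principal {(x, y). dist x y < e})"
    by (fact uniformity_exterior_def)
  show "open U \<longleftrightarrow> (\<forall>x\<in>U. eventually (\<lambda>(x', y). x' = x \<longrightarrow> y \<in> U) uniformity)"
    for U :: "'a exterior set"
    by (fact open_exterior_def)
  show "(Basis :: 'a exterior set) \<noteq> {}" "finite (Basis :: 'a exterior set)"
    by (auto simp: Basis_exterior_def)
  show "(\<forall>u\<in>Basis. x \<bullet> u = 0) \<longleftrightarrow> x = 0"
  proof
    assume "\<forall>u\<in>Basis. x \<bullet> u = 0"
    then show "x = 0"
      by (intro exterior_eqI) (auto simp: Basis_exterior_def inner_ext_monom)
  qed (simp add: inner_exterior_def)
  fix u v :: "'a exterior" assume "u \<in> Basis" "v \<in> Basis"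
  then obtain S T where ST: "u = ext_monom S" "v = ext_monom T" "S \<subseteq> Basis" "T \<subseteq> Basis"
    by (auto simp: Basis_exterior_def)
  have "u = v \<longleftrightarrow> S = T"
    by (metis ST ext_monom.rep_eq zero_neq_one)
  then show "u \<bullet> v = (if u = v then 1 else 0)"
    using ST by (simp add: inner_ext_monom ext_monom.rep_eq)
qed

end

text \<open>
  \<open>shuffle_sign A B\<close> is the sign of the permutation sorting the increasing enumeration of \<open>A\<close>
  followed by the increasing enumeration of \<open>B\<close>.
\<close>

definition shuffle_sign :: "'a::euclidean_space set \<Rightarrow> 'a set \<Rightarrow> real"
  where "shuffle_sign A B =
    (-1) ^ card {(a, b). a \<in> A \<and> b \<in> B \<and> to_nat_on (Basis :: 'a set) b < to_nat_on (Basis :: 'a set) a}"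

lemma finite_inversions:
  assumes "finite A" "finite B"
  shows "finite {(a, b). a \<in> A \<and> b \<in> B \<and> P a b}"
  by (rule finite_subset[of _ "A \<times> B"]) (use assms in auto)

lemma shuffle_sign_Un_right:
  assumes "finite A" "finite B" "finite C" "B \<inter> C = {}"
  shows "shuffle_sign A (B \<union> C) = shuffle_sign A B * shuffle_sign A C"
proof -
  let ?P = "\<lambda>(a::'a) b. to_nat_on (Basis :: 'a set) b < to_nat_on (Basis :: 'a set) a"
  have "{(a, b). a \<in> A \<and> b \<in> B \<union> C \<and> ?P a b}
      = {(a, b). a \<in> A \<and> b \<in> B \<and> ?P a b} \<union> {(a, b). a \<in> A \<and> b \<in> C \<and> ?P a b}"
    by auto
  moreover have "card \<dots> = card {(a, b). a \<in> A \<and> b \<in> B \<and> ?P a b}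
      + card {(a, b). a \<in> A \<and> b \<in> C \<and> ?P a b}"
    by (intro card_Un_disjoint finite_inversions) (use assms in auto)
  ultimately show ?thesis
    by (simp add: shuffle_sign_def power_add)
qed

lemma shuffle_sign_Un_left:
  assumes "finite A" "finite B" "finite C" "A \<inter> B = {}"
  shows "shuffle_sign (A \<union> B) C = shuffle_sign A C * shuffle_sign B C"
proof -
  let ?P = "\<lambda>(a::'a) b. to_nat_on (Basis :: 'a set) b < to_nat_on (Basis :: 'a set) a"
  have "{(a, b). a \<in> A \<union> B \<and> b \<in> C \<and> ?P a b}
      = {(a, b). a \<in> A \<and> b \<in> C \<and> ?P a b} \<union> {(a, b). a \<in> B \<and> b \<in> C \<and> ?P a b}"
    by auto
  moreover have "card \<dots> = card {(a, b). a \<in> A \<and> b \<in> C \<and> ?P a b}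
      + card {(a, b). a \<in> B \<and> b \<in> C \<and> ?P a b}"
    by (intro card_Un_disjoint finite_inversions) (use assms in auto)
  ultimately show ?thesis
    by (simp add: shuffle_sign_def power_add)
qed

lemma shuffle_sign_empty [simp]: "shuffle_sign {} A = 1" "shuffle_sign A {} = 1"
  by (simp_all add: shuffle_sign_def)

lemma shuffle_sign_square [simp]: "shuffle_sign A B * shuffle_sign A B = 1"
  by (simp add: shuffle_sign_def flip: power_add)

lemma shuffle_sign_singletons:
  assumes "a \<in> Basis" "b \<in> Basis" "a \<noteq> b"
  shows "shuffle_sign {a} {b} * shuffle_sign {b} {a} = -1"
proof -
  have "to_nat_on (Basis :: 'a set) a \<noteq> to_nat_on (Basis :: 'a set) b"
    using assms by (simp add: countable_finite)
  moreover have *: "shuffle_sign {c} {d}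
      = (if to_nat_on (Basis :: 'a set) d < to_nat_on (Basis :: 'a set) c then -1 else 1)" for c d
  proof -
    have "{(a, b). a \<in> {c} \<and> b \<in> {d}
          \<and> to_nat_on (Basis :: 'a set) b < to_nat_on (Basis :: 'a set) a}
        = (if to_nat_on (Basis :: 'a set) d < to_nat_on (Basis :: 'a set) c then {(c, d)} else {})"
      by auto
    then show ?thesis by (simp add: shuffle_sign_def)
  qed
  ultimately show ?thesis by auto
qed

lemma exterior_mult_support:
  fixes f g :: "'a::euclidean_space set \<Rightarrow> real"
  assumes "\<And>S. \<not> S \<subseteq> Basis \<Longrightarrow> f S = 0" "\<And>S. \<not> S \<subseteq> Basis \<Longrightarrow> g S = 0"
    and S: "\<not> S \<subseteq> Basis"
  shows "(\<Sum>A\<in>Pow S. shuffle_sign A (S - A) * f A * g (S - A)) = 0"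
proof (intro sum.neutral ballI)
  fix A assume "A \<in> Pow S"
  then have "\<not> A \<subseteq> Basis \<or> \<not> S - A \<subseteq> Basis" using S by blast
  then show "shuffle_sign A (S - A) * f A * g (S - A) = 0"
    by (elim disjE) (simp_all add: assms)
qed

text \<open>The multiplication of the exterior algebra is the exterior (wedge) product.\<close>

instantiation exterior :: (euclidean_space) real_algebra_1
begin

lift_definition one_exterior :: "'a exterior" is "\<lambda>S. if S = {} then 1 else 0" by auto

lift_definition times_exterior :: "'a exterior \<Rightarrow> 'a exterior \<Rightarrow> 'a exterior"
  is "\<lambda>f g S. \<Sum>A\<in>Pow S. shuffle_sign A (S - A) * f A * g (S - A)"
  by (rule exterior_mult_support)

lemma ext_mult_assoc:
  fixes x y z :: "'a exterior"
  shows "x * y * z = x * (y * z)"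
proof (rule exterior_eqI)
  fix S :: "'a set" assume S: "S \<subseteq> Basis"
  then have fS: "finite S" using finite_Basis finite_subset by blast
  have fin: "finite (Pow T)" if "T \<subseteq> S" for T using that fS finite_subset by blast
  have "ext_coeff (x * y * z) S
      = (\<Sum>T\<in>Pow S. \<Sum>A\<in>Pow T. shuffle_sign T (S - T) * shuffle_sign A (T - A)
           * ext_coeff x A * ext_coeff y (T - A) * ext_coeff z (S - T))"
    by (simp add: times_exterior.rep_eq sum_distrib_left sum_distrib_right mult_ac)
  also have "\<dots> = (\<Sum>(T, A)\<in>Sigma (Pow S) Pow. shuffle_sign T (S - T) * shuffle_sign A (T - A)
           * ext_coeff x A * ext_coeff y (T - A) * ext_coeff z (S - T))"
    by (subst sum.Sigma) (use fin fS in auto)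
  also have "\<dots> = (\<Sum>(A, B)\<in>Sigma (Pow S) (\<lambda>A. Pow (S - A)).
           shuffle_sign A (S - A) * shuffle_sign B (S - A - B)
           * ext_coeff x A * ext_coeff y B * ext_coeff z (S - A - B))"
  proof (rule sum.reindex_bij_witness[where i = "\<lambda>(A, B). (A \<union> B, A)" and j = "\<lambda>(T, A). (A, T - A)"])
    fix p assume "p \<in> Sigma (Pow S) Pow"
    then obtain T A where p: "p = (T, A)" "A \<subseteq> T" "T \<subseteq> S" by auto
    then have f: "finite A" "finite (T - A)" "finite (S - T)"
      using fS by (auto intro: finite_subset)
    have e: "A \<union> (T - A) = T" "(T - A) \<union> (S - T) = S - A" "S - A - (T - A) = S - T"
      using p by auto
    have "shuffle_sign T (S - T) = shuffle_sign A (S - T) * shuffle_sign (T - A) (S - T)"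
      using shuffle_sign_Un_left[OF f] e by auto
    moreover have "shuffle_sign A (S - A) = shuffle_sign A (T - A) * shuffle_sign A (S - T)"
      using shuffle_sign_Un_right[OF f] e by auto
    ultimately show "(case (case p of (T, A) \<Rightarrow> (A, T - A)) of (A, B) \<Rightarrow>
           shuffle_sign A (S - A) * shuffle_sign B (S - A - B)
           * ext_coeff x A * ext_coeff y B * ext_coeff z (S - A - B)) =
        (case p of (T, A) \<Rightarrow> shuffle_sign T (S - T) * shuffle_sign A (T - A)
           * ext_coeff x A * ext_coeff y (T - A) * ext_coeff z (S - T))"
      using p e by simp
  qed auto
  also have "\<dots> = (\<Sum>A\<in>Pow S. \<Sum>B\<in>Pow (S - A).
           shuffle_sign A (S - A) * shuffle_sign B (S - A - B)
           * ext_coeff x A * ext_coeff y B * ext_coeff z (S - A - B))"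
    by (subst sum.Sigma) (use fin fS in auto)
  also have "\<dots> = ext_coeff (x * (y * z)) S"
    by (simp add: times_exterior.rep_eq sum_distrib_left sum_distrib_right mult_ac)
  finally show "ext_coeff (x * y * z) S = ext_coeff (x * (y * z)) S" .
qed

instance
proof
  fix x y z :: "'a exterior" and r :: real
  show "x * y * z = x * (y * z)" by (fact ext_mult_assoc)
  show "(x + y) * z = x * z + y * z" "x * (y + z) = x * y + x * z"
    "r *\<^sub>R x * y = r *\<^sub>R (x * y)" "x * r *\<^sub>R y = r *\<^sub>R (x * y)"
    by (auto intro!: exterior_eqI
        simp: times_exterior.rep_eq algebra_simps sum.distrib sum_distrib_left)
  show "(0 :: 'a exterior) \<noteq> 1"
    by transfer (auto simp: fun_eq_iff)
  show "1 * x = x"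
  proof (rule exterior_eqI)
    fix S :: "'a set" assume "S \<subseteq> Basis"
    then have "finite S" using finite_Basis finite_subset by blast
    have "ext_coeff (1 * x) S = (\<Sum>A\<in>Pow S. if A = {} then ext_coeff x S else 0)"
      unfolding times_exterior.rep_eq one_exterior.rep_eq by (intro sum.cong) auto
    then show "ext_coeff (1 * x) S = ext_coeff x S" using \<open>finite S\<close> by simp
  qed
  show "x * 1 = x"
  proof (rule exterior_eqI)
    fix S :: "'a set" assume "S \<subseteq> Basis"
    then have "finite S" using finite_Basis finite_subset by blast
    have "ext_coeff (x * 1) S = (\<Sum>A\<in>Pow S. if A = S then ext_coeff x S else 0)"
      unfolding times_exterior.rep_eq one_exterior.rep_eq by (intro sum.cong) auto
    then show "ext_coeff (x * 1) S = ext_coeff x S" using \<open>finite S\<close> by simp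
  qed
qed

end

lift_definition ext_vec :: "'a::euclidean_space \<Rightarrow> 'a exterior"
  is "\<lambda>v S. \<Sum>b\<in>Basis. if S = {b} then v \<bullet> b else 0"
  by (auto intro!: sum.neutral)

definition ext_wedge :: "'a::euclidean_space list \<Rightarrow> 'a exterior"
  where "ext_wedge vs = prod_list (map ext_vec vs)"


lemma ext_coeff_vec_singleton:
  assumes "b \<in> Basis"
  shows "ext_coeff (ext_vec v) {b} = v \<bullet> b"
  using assms by (simp add: ext_vec.rep_eq)

lemma linear_ext_vec: "linear ext_vec"
  by standard (auto intro!: exterior_eqI
      simp: ext_vec.rep_eq inner_left_distrib sum_distrib_left sum.distrib[symmetric] intro!: sum.cong)

lemma ext_coeff_vec_mult:
  fixes S :: "'a::euclidean_space set"
  assumes S: "S \<subseteq> Basis"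
  shows "ext_coeff (ext_vec v * x) S
    = (\<Sum>b\<in>S. (v \<bullet> b) * shuffle_sign {b} (S - {b}) * ext_coeff x (S - {b}))"
proof -
  have fS: "finite S" using S finite_Basis finite_subset by blast
  have "ext_coeff (ext_vec v * x) S
      = (\<Sum>A\<in>Pow S. shuffle_sign A (S - A) * ext_coeff (ext_vec v) A * ext_coeff x (S - A))"
    by (simp add: times_exterior.rep_eq)
  also have "\<dots> = (\<Sum>A\<in>(\<lambda>b. {b}) ` S. shuffle_sign A (S - A) * ext_coeff (ext_vec v) A * ext_coeff x (S - A))"
  proof (rule sum.mono_neutral_right)
    show "finite (Pow S)" "(\<lambda>b. {b}) ` S \<subseteq> Pow S" using fS by auto
    show "\<forall>A\<in>Pow S - (\<lambda>b. {b}) ` S. shuffle_sign A (S - A) * ext_coeff (ext_vec v) A * ext_coeff x (S - A) = 0"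
    proof
      fix A assume "A \<in> Pow S - (\<lambda>b. {b}) ` S"
      then have "A \<noteq> {b}" for b by auto
      then have "ext_coeff (ext_vec v) A = 0" by (simp add: ext_vec.rep_eq)
      then show "shuffle_sign A (S - A) * ext_coeff (ext_vec v) A * ext_coeff x (S - A) = 0" by simp
    qed
  qed
  also have "\<dots> = (\<Sum>b\<in>S. shuffle_sign {b} (S - {b}) * ext_coeff (ext_vec v) {b} * ext_coeff x (S - {b}))"
    by (subst sum.reindex) (auto simp: inj_on_def)
  also have "\<dots> = (\<Sum>b\<in>S. (v \<bullet> b) * shuffle_sign {b} (S - {b}) * ext_coeff x (S - {b}))"
    using S by (intro sum.cong) (auto simp: ext_coeff_vec_singleton)
  finally show ?thesis .
qed

text \<open>Interior multiplication, the adjoint of exterior multiplication by a vector.\<close>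

lift_definition ext_contract :: "'a::euclidean_space \<Rightarrow> 'a exterior \<Rightarrow> 'a exterior"
  is "\<lambda>v f S. if S \<subseteq> Basis
    then \<Sum>b\<in>Basis - S. (v \<bullet> b) * shuffle_sign {b} S * f (insert b S) else 0"
  by simp

lemma inner_vec_mult: "(ext_vec v * x) \<bullet> y = x \<bullet> ext_contract v y"
proof -
  have fin: "finite S" if "S \<subseteq> Basis" for S :: "'a set"
    using that finite_Basis finite_subset by blast
  have "(ext_vec v * x) \<bullet> y = (\<Sum>S\<in>Pow Basis. \<Sum>b\<in>S.
      (v \<bullet> b) * shuffle_sign {b} (S - {b}) * ext_coeff x (S - {b}) * ext_coeff y S)"
    unfolding inner_exterior_def
    by (intro sum.cong) (auto simp: ext_coeff_vec_mult sum_distrib_right)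
  also have "\<dots> = (\<Sum>(S, b)\<in>Sigma (Pow Basis) (\<lambda>S. S).
      (v \<bullet> b) * shuffle_sign {b} (S - {b}) * ext_coeff x (S - {b}) * ext_coeff y S)"
    by (subst sum.Sigma) (use fin in auto)
  also have "\<dots> = (\<Sum>(S, b)\<in>Sigma (Pow Basis) (\<lambda>S. Basis - S).
      (v \<bullet> b) * shuffle_sign {b} S * ext_coeff x S * ext_coeff y (insert b S))"
    by (rule sum.reindex_bij_witness[where i = "\<lambda>(S, b). (insert b S, b)" and j = "\<lambda>(S, b). (S - {b}, b)"])
      (auto simp: insert_absorb)
  also have "\<dots> = (\<Sum>S\<in>Pow Basis. \<Sum>b\<in>Basis - S.
      (v \<bullet> b) * shuffle_sign {b} S * ext_coeff x S * ext_coeff y (insert b S))"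
    by (subst sum.Sigma) (use fin in auto)
  also have "\<dots> = x \<bullet> ext_contract v y"
    unfolding inner_exterior_def
    by (intro sum.cong) (auto simp: ext_contract.rep_eq sum_distrib_left mult_ac)
  finally show ?thesis .
qed

lemma ext_contract_vec_mult:
  "ext_contract u (ext_vec v * y) = (u \<bullet> v) *\<^sub>R y - ext_vec v * ext_contract u y"
proof (rule exterior_eqI)
  fix S :: "'a set" assume S: "S \<subseteq> Basis"
  have fS: "finite S" using S finite_Basis finite_subset by blast
  let ?y = "ext_coeff y"
  define R where "R = (\<Sum>b\<in>Basis - S. \<Sum>d\<in>S. (u \<bullet> b) * (v \<bullet> d)
      * shuffle_sign {b} S * shuffle_sign {d} (insert b (S - {d})) * ?y (insert b (S - {d})))"
  have "ext_coeff (ext_contract u (ext_vec v * y)) S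
      = (\<Sum>b\<in>Basis - S. (u \<bullet> b) * shuffle_sign {b} S * (\<Sum>d\<in>insert b S.
          (v \<bullet> d) * shuffle_sign {d} (insert b S - {d}) * ?y (insert b S - {d})))"
    using S by (simp add: ext_contract.rep_eq ext_coeff_vec_mult)
  also have "\<dots> = (\<Sum>b\<in>Basis - S. (u \<bullet> b) * (v \<bullet> b) * ?y S + (\<Sum>d\<in>S. (u \<bullet> b) * (v \<bullet> d)
      * shuffle_sign {b} S * shuffle_sign {d} (insert b (S - {d})) * ?y (insert b (S - {d}))))"
  proof (intro sum.cong refl)
    fix b assume b: "b \<in> Basis - S"
    have "(\<Sum>d\<in>insert b S. (v \<bullet> d) * shuffle_sign {d} (insert b S - {d}) * ?y (insert b S - {d}))
      = (v \<bullet> b) * shuffle_sign {b} S * ?y S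
        + (\<Sum>d\<in>S. (v \<bullet> d) * shuffle_sign {d} (insert b S - {d}) * ?y (insert b S - {d}))"
      using b fS by simp
    also have "(\<Sum>d\<in>S. (v \<bullet> d) * shuffle_sign {d} (insert b S - {d}) * ?y (insert b S - {d}))
      = (\<Sum>d\<in>S. (v \<bullet> d) * shuffle_sign {d} (insert b (S - {d})) * ?y (insert b (S - {d})))"
    proof (intro sum.cong refl)
      fix d assume "d \<in> S"
      then have "insert b S - {d} = insert b (S - {d})" using b by auto
      then show "(v \<bullet> d) * shuffle_sign {d} (insert b S - {d}) * ?y (insert b S - {d})
          = (v \<bullet> d) * shuffle_sign {d} (insert b (S - {d})) * ?y (insert b (S - {d}))" by simp
    qed
    finally have e: "(\<Sum>d\<in>insert b S. (v \<bullet> d) * shuffle_sign {d} (insert b S - {d}) * ?y (insert b S - {d}))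
      = (v \<bullet> b) * shuffle_sign {b} S * ?y S
        + (\<Sum>d\<in>S. (v \<bullet> d) * shuffle_sign {d} (insert b (S - {d})) * ?y (insert b (S - {d})))" .
    have "(u \<bullet> b) * shuffle_sign {b} S * ((v \<bullet> b) * shuffle_sign {b} S * ?y S)
        = (u \<bullet> b) * (v \<bullet> b) * ?y S * (shuffle_sign {b} S * shuffle_sign {b} S)"
      by (simp only: mult_ac)
    then show "(u \<bullet> b) * shuffle_sign {b} S * (\<Sum>d\<in>insert b S.
          (v \<bullet> d) * shuffle_sign {d} (insert b S - {d}) * ?y (insert b S - {d}))
      = (u \<bullet> b) * (v \<bullet> b) * ?y S + (\<Sum>d\<in>S. (u \<bullet> b) * (v \<bullet> d)
          * shuffle_sign {b} S * shuffle_sign {d} (insert b (S - {d})) * ?y (insert b (S - {d})))"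
      unfolding e by (simp add: distrib_left sum_distrib_left mult_ac)
  qed
  also have "\<dots> = (\<Sum>b\<in>Basis - S. (u \<bullet> b) * (v \<bullet> b)) * ?y S + R"
    by (simp add: sum.distrib R_def sum_distrib_right)
  finally have 1: "ext_coeff (ext_contract u (ext_vec v * y)) S
      = (\<Sum>b\<in>Basis - S. (u \<bullet> b) * (v \<bullet> b)) * ?y S + R" .
  have "ext_coeff (ext_vec v * ext_contract u y) S
      = (\<Sum>d\<in>S. (v \<bullet> d) * shuffle_sign {d} (S - {d}) * (\<Sum>b\<in>insert d (Basis - S).
          (u \<bullet> b) * shuffle_sign {b} (S - {d}) * ?y (insert b (S - {d}))))"
  proof -
    have "ext_coeff (ext_contract u y) (S - {d}) = (\<Sum>b\<in>insert d (Basis - S).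
          (u \<bullet> b) * shuffle_sign {b} (S - {d}) * ?y (insert b (S - {d})))" if "d \<in> S" for d
    proof -
      have "Basis - (S - {d}) = insert d (Basis - S)" "S - {d} \<subseteq> Basis" using S that by auto
      then show ?thesis by (simp add: ext_contract.rep_eq)
    qed
    then show ?thesis using S by (simp add: ext_coeff_vec_mult)
  qed
  also have "\<dots> = (\<Sum>d\<in>S. (u \<bullet> d) * (v \<bullet> d) * ?y S - (\<Sum>b\<in>Basis - S. (u \<bullet> b) * (v \<bullet> d)
      * shuffle_sign {b} S * shuffle_sign {d} (insert b (S - {d})) * ?y (insert b (S - {d}))))"
  proof (intro sum.cong refl)
    fix d assume d: "d \<in> S"
    have "(\<Sum>b\<in>insert d (Basis - S). (u \<bullet> b) * shuffle_sign {b} (S - {d}) * ?y (insert b (S - {d})))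
      = (u \<bullet> d) * shuffle_sign {d} (S - {d}) * ?y S
        + (\<Sum>b\<in>Basis - S. (u \<bullet> b) * shuffle_sign {b} (S - {d}) * ?y (insert b (S - {d})))"
      using d by (simp add: insert_absorb)
    moreover have "(v \<bullet> d) * shuffle_sign {d} (S - {d}) * ((u \<bullet> d) * shuffle_sign {d} (S - {d}) * ?y S)
        = (u \<bullet> d) * (v \<bullet> d) * ?y S * (shuffle_sign {d} (S - {d}) * shuffle_sign {d} (S - {d}))"
      by (simp only: mult_ac)
    moreover have "(\<Sum>b\<in>Basis - S. (v \<bullet> d) * shuffle_sign {d} (S - {d})
          * ((u \<bullet> b) * shuffle_sign {b} (S - {d}) * ?y (insert b (S - {d}))))
      = - (\<Sum>b\<in>Basis - S. (u \<bullet> b) * (v \<bullet> d)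
      * shuffle_sign {b} S * shuffle_sign {d} (insert b (S - {d})) * ?y (insert b (S - {d})))"
      unfolding sum_negf[symmetric]
    proof (intro sum.cong refl)
      fix b assume b: "b \<in> Basis - S"
      have "shuffle_sign {b} ({d} \<union> (S - {d})) = shuffle_sign {b} {d} * shuffle_sign {b} (S - {d})"
        by (rule shuffle_sign_Un_right) (use fS in auto)
      then have s1: "shuffle_sign {b} S = shuffle_sign {b} {d} * shuffle_sign {b} (S - {d})"
        using d by (simp add: insert_absorb)
      have "shuffle_sign {d} ({b} \<union> (S - {d})) = shuffle_sign {d} {b} * shuffle_sign {d} (S - {d})"
        by (rule shuffle_sign_Un_right) (use fS b in auto)
      then have s2: "shuffle_sign {d} (insert b (S - {d})) = shuffle_sign {d} {b} * shuffle_sign {d} (S - {d})"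
        by simp
      have s3: "shuffle_sign {b} {d} * shuffle_sign {d} {b} = -1"
        by (rule shuffle_sign_singletons) (use b d S in auto)
      have "shuffle_sign {b} S * shuffle_sign {d} (insert b (S - {d}))
          = (shuffle_sign {b} {d} * shuffle_sign {d} {b}) * (shuffle_sign {b} (S - {d}) * shuffle_sign {d} (S - {d}))"
        unfolding s1 s2 by (simp only: mult_ac)
      then have s4: "shuffle_sign {b} S * shuffle_sign {d} (insert b (S - {d}))
          = - (shuffle_sign {b} (S - {d}) * shuffle_sign {d} (S - {d}))"
        unfolding s3 by simp
      have "- ((u \<bullet> b) * (v \<bullet> d) * shuffle_sign {b} S * shuffle_sign {d} (insert b (S - {d})) * ?y (insert b (S - {d})))
        = - ((u \<bullet> b) * (v \<bullet> d) * (shuffle_sign {b} S * shuffle_sign {d} (insert b (S - {d}))) * ?y (insert b (S - {d})))"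
        by (simp only: mult_ac)
      then show "(v \<bullet> d) * shuffle_sign {d} (S - {d})
          * ((u \<bullet> b) * shuffle_sign {b} (S - {d}) * ?y (insert b (S - {d})))
        = - ((u \<bullet> b) * (v \<bullet> d) * shuffle_sign {b} S * shuffle_sign {d} (insert b (S - {d}))
          * ?y (insert b (S - {d})))"
        unfolding s4 by simp
    qed
    ultimately show "(v \<bullet> d) * shuffle_sign {d} (S - {d}) * (\<Sum>b\<in>insert d (Basis - S).
          (u \<bullet> b) * shuffle_sign {b} (S - {d}) * ?y (insert b (S - {d})))
      = (u \<bullet> d) * (v \<bullet> d) * ?y S - (\<Sum>b\<in>Basis - S. (u \<bullet> b) * (v \<bullet> d)
          * shuffle_sign {b} S * shuffle_sign {d} (insert b (S - {d})) * ?y (insert b (S - {d})))"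
      by (simp only: distrib_left sum_distrib_left shuffle_sign_square mult_1_right diff_conv_add_uminus)
  qed
  also have "\<dots> = (\<Sum>d\<in>S. (u \<bullet> d) * (v \<bullet> d)) * ?y S - R"
    unfolding R_def by (subst sum.swap) (simp add: sum_subtractf sum_distrib_right)
  finally have 2: "ext_coeff (ext_vec v * ext_contract u y) S
      = (\<Sum>d\<in>S. (u \<bullet> d) * (v \<bullet> d)) * ?y S - R" .
  have "u \<bullet> v = (\<Sum>b\<in>Basis. (u \<bullet> b) * (v \<bullet> b))"
    by (rule euclidean_inner)
  also have "\<dots> = (\<Sum>b\<in>Basis - S. (u \<bullet> b) * (v \<bullet> b)) + (\<Sum>b\<in>S. (u \<bullet> b) * (v \<bullet> b))"
    using S by (simp add: sum.subset_diff)
  finally show "ext_coeff (ext_contract u (ext_vec v * y)) S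
      = ext_coeff ((u \<bullet> v) *\<^sub>R y - ext_vec v * ext_contract u y) S"
    using 1 2 by (simp add: algebra_simps)
qed

lemma ext_contract_one [simp]: "ext_contract v 1 = 0"
  by (rule exterior_eqI) (simp add: ext_contract.rep_eq one_exterior.rep_eq)

lemma ext_wedge_Nil [simp]: "ext_wedge [] = 1"
  and ext_wedge_Cons [simp]: "ext_wedge (v # vs) = ext_vec v * ext_wedge vs"
  and ext_wedge_append: "ext_wedge (us @ vs) = ext_wedge us * ext_wedge vs"
  by (simp_all add: ext_wedge_def)

lemma ext_contract_wedge:
  "ext_contract u (ext_wedge vs)
    = (\<Sum>j<length vs. ((-1) ^ j * (u \<bullet> vs ! j)) *\<^sub>R ext_wedge (take j vs @ drop (Suc j) vs))"
proof (induction vs)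
  case (Cons v vs)
  have "(\<Sum>j<length (v # vs). ((-1) ^ j * (u \<bullet> (v # vs) ! j)) *\<^sub>R ext_wedge (take j (v # vs) @ drop (Suc j) (v # vs)))
     = (u \<bullet> v) *\<^sub>R ext_wedge vs - ext_vec v * ext_contract u (ext_wedge vs)"
    unfolding Cons.IH
    by (simp add: sum.lessThan_Suc_shift sum_distrib_left sum_negf[symmetric] del: sum.lessThan_Suc)
  then show ?case by (simp add: ext_contract_vec_mult)
qed simp

theorem inner_ext_wedge_degree:
  assumes "length us \<noteq> length vs"
  shows "ext_wedge us \<bullet> ext_wedge vs = 0"
  using assms
proof (induction us arbitrary: vs)
  case Nil
  then obtain v vs' where "vs = v # vs'" by (cases vs) auto
  then show ?case by (simp add: inner_commute[of 1] inner_vec_mult)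
next
  case (Cons u us)
  have "ext_wedge us \<bullet> ext_wedge (take j vs @ drop (Suc j) vs) = 0" if "j < length vs" for j
    by (rule Cons.IH) (use that Cons.prems in auto)
  then show ?case
    by (simp add: inner_vec_mult ext_contract_wedge[of u vs] inner_sum_right)
qed

theorem inner_ext_wedge:
  fixes us vs :: "'a::euclidean_space list"
  assumes "length us = k" "length vs = k"
  shows "ext_wedge us \<bullet> ext_wedge vs = Determinant.det (Matrix.mat k k (\<lambda>(i, j). us ! i \<bullet> vs ! j))"
  using assms
proof (induction k arbitrary: us vs)
  case 0
  have "(1 :: 'a exterior) \<bullet> 1 = 1"
  proof -
    have "(1 :: 'a exterior) = ext_monom {}" by (rule exterior_eqI) (simp add: one_exterior.rep_eq ext_monom.rep_eq)
    then show ?thesis using inner_ext_monom[of "{}" "1 :: 'a exterior"] by (simp add: one_exterior.rep_eq)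
  qed
  then show ?case using 0 by (simp add: Determinant.det_def)
next
  case (Suc k)
  then obtain u us' where us: "us = u # us'" "length us' = k" by (cases us) auto
  let ?A = "Matrix.mat (Suc k) (Suc k) (\<lambda>(i, j). us ! i \<bullet> vs ! j)"
  have "Determinant.det ?A = (\<Sum>j<Suc k. ?A $$ (0, j) * cofactor ?A 0 j)"
    by (rule laplace_expansion_row) auto
  also have "\<dots> = (\<Sum>j<Suc k. (-1) ^ j * (u \<bullet> vs ! j) * (ext_wedge us' \<bullet> ext_wedge (take j vs @ drop (Suc j) vs)))"
  proof (intro sum.cong refl)
    fix j assume j: "j \<in> {..<Suc k}"
    let ?w = "take j vs @ drop (Suc j) vs"
    have "mat_delete ?A 0 j = Matrix.mat k k (\<lambda>(i, l). us' ! i \<bullet> ?w ! l)"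
      by (rule eq_matI) (use us j Suc.prems in \<open>auto simp: mat_delete_def nth_append\<close>)
    moreover have "ext_wedge us' \<bullet> ext_wedge ?w = Determinant.det (Matrix.mat k k (\<lambda>(i, l). us' ! i \<bullet> ?w ! l))"
      by (rule Suc.IH) (use us j Suc.prems in auto)
    ultimately show "?A $$ (0, j) * cofactor ?A 0 j
        = (-1) ^ j * (u \<bullet> vs ! j) * (ext_wedge us' \<bullet> ext_wedge ?w)"
      using us j by (simp add: cofactor_def)
  qed
  also have "\<dots> = ext_wedge us \<bullet> ext_wedge vs"
    using us Suc.prems by (simp add: inner_vec_mult ext_contract_wedge inner_sum_right del: sum.lessThan_Suc)
  finally show ?case by simp
qed

lemma ext_vec_square: "ext_vec v * ext_vec v = 0"
proof (rule exterior_eqI)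
  fix S :: "'a set" assume S: "S \<subseteq> Basis"
  have "ext_contract v (ext_vec v * ext_vec v) = 0"
    using ext_contract_vec_mult[of v v "ext_vec v"] ext_contract_vec_mult[of v v 1] by simp
  then have "(ext_vec v * ext_vec v) \<bullet> (ext_vec v * ext_vec v) = 0"
    by (simp add: inner_vec_mult)
  then show "ext_coeff (ext_vec v * ext_vec v) S = ext_coeff 0 S" by simp
qed

definition ext_power :: "nat \<Rightarrow> 'a::euclidean_space exterior set"
  where "ext_power k = span {ext_wedge vs | vs. length vs = k}"

lemma ext_monom_wedge:
  assumes "S \<subseteq> Basis"
  shows "\<exists>vs r. length vs = card S \<and> ext_monom S = r *\<^sub>R ext_wedge vs"
proof -
  have "finite S" using assms finite_Basis finite_subset by blast
  then show ?thesis using assms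
  proof (induction S rule: finite_induct)
    case empty
    have "(1 :: 'a exterior) = ext_monom {}"
      by (rule exterior_eqI) (simp add: one_exterior.rep_eq ext_monom.rep_eq)
    then show ?case by (intro exI[of _ "[]"] exI[of _ 1]) simp
  next
    case (insert b S)
    then obtain vs r where IH: "length vs = card S" "ext_monom S = r *\<^sub>R ext_wedge vs" by auto
    have "ext_vec b * ext_monom S = shuffle_sign {b} S *\<^sub>R ext_monom (insert b S)"
    proof (rule exterior_eqI)
      fix T :: "'a set" assume T: "T \<subseteq> Basis"
      then have fT: "finite T" using finite_Basis finite_subset by blast
      have "ext_coeff (ext_vec b * ext_monom S) T
          = (\<Sum>d\<in>T. if d = b then shuffle_sign {b} (T - {b}) * ext_coeff (ext_monom S) (T - {b}) else 0)"
        unfolding ext_coeff_vec_mult[OF T]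
        by (intro sum.cong refl) (use insert.prems T in \<open>auto simp: inner_Basis subset_iff\<close>)
      also have "\<dots> = (if b \<in> T then shuffle_sign {b} (T - {b}) * ext_coeff (ext_monom S) (T - {b}) else 0)"
        using fT by simp
      also have "\<dots> = shuffle_sign {b} S * ext_coeff (ext_monom (insert b S)) T"
        using insert.hyps insert.prems T by (auto simp: ext_monom.rep_eq)
      finally show "ext_coeff (ext_vec b * ext_monom S) T
          = ext_coeff (shuffle_sign {b} S *\<^sub>R ext_monom (insert b S)) T" by simp
    qed
    then have "ext_monom (insert b S) = shuffle_sign {b} S *\<^sub>R (ext_vec b * ext_monom S)" by simp
    also have "\<dots> = (shuffle_sign {b} S * r) *\<^sub>R ext_wedge (b # vs)" using IH by simp
    finally show ?case using IH insert.hyps by (intro exI[of _ "b # vs"]) auto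
  qed
qed

lemma ext_monom_in_power:
  assumes "S \<subseteq> Basis"
  shows "ext_monom S \<in> ext_power (card S)"
proof -
  obtain vs r where vs: "length vs = card S" "ext_monom S = r *\<^sub>R ext_wedge vs"
    using ext_monom_wedge[OF assms] by blast
  show ?thesis unfolding ext_power_def vs(2)
    by (rule span_mul, rule span_base) (use vs in auto)
qed

theorem span_ext_wedge: "span (range ext_wedge) = (UNIV :: 'a::euclidean_space exterior set)"
proof -
  have "m \<in> span (range ext_wedge)" if "m \<in> Basis" for m :: "'a exterior"
  proof -
    obtain S where S: "S \<subseteq> Basis" "m = ext_monom S"
      using \<open>m \<in> Basis\<close> by (auto simp: Basis_exterior_def)
    obtain vs r where "m = r *\<^sub>R ext_wedge vs"
      using ext_monom_wedge[OF S(1)] unfolding S(2)[symmetric] by blast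
    then show ?thesis by (simp add: span_mul span_base)
  qed
  then have "span (Basis :: 'a exterior set) \<subseteq> span (range ext_wedge)"
    by (intro span_minimal subsetI) auto
  then show ?thesis by auto
qed


section \<open>Orientation, determinant and multiple cross product\<close>

definition orthonormal_basis :: "'a::euclidean_space list \<Rightarrow> bool"
  where "orthonormal_basis B \<longleftrightarrow> length B = DIM('a) \<and>
    (\<forall>i<DIM('a). \<forall>j<DIM('a). B ! i \<bullet> B ! j = (if i = j then 1 else 0))"

text \<open>
  In the following, an orientation of the space is represented by one of its positive orthonormal
  bases \<open>B\<close>, and \<open>ext_wedge B\<close> is the unit volume element. Replacing \<open>B\<close> by another positive
  orthonormal basis changes neither \<open>coord_det B\<close> nor \<open>multi_cross B\<close>.
\<close>

definition coord_det :: "'a::euclidean_space list \<Rightarrow> 'a list \<Rightarrow> real"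
  where "coord_det B vs =
    Determinant.det (Matrix.mat DIM('a) DIM('a) (\<lambda>(i, j). vs ! i \<bullet> B ! j))"

definition positive_orthonormal_basis :: "'a::euclidean_space list \<Rightarrow> 'a list \<Rightarrow> bool"
  where "positive_orthonormal_basis B E \<longleftrightarrow> orthonormal_basis E \<and> coord_det B E > 0"

definition multi_cross :: "'a::euclidean_space list \<Rightarrow> 'a list \<Rightarrow> 'a exterior"
  where "multi_cross B vs = (THE x. x \<in> ext_power (DIM('a) - length vs) \<and>
    (\<forall>w. x \<bullet> w = ext_wedge B \<bullet> (ext_wedge vs * w)))"

lemma norm_ext_wedge_orthonormal:
  assumes "orthonormal_basis B"
  shows "norm (ext_wedge B) = 1"
proof -
  let ?n = "DIM('a)"
  have "ext_wedge B \<bullet> ext_wedge B = Determinant.det (Matrix.mat ?n ?n (\<lambda>(i, j). B ! i \<bullet> B ! j))"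
    by (rule inner_ext_wedge) (use assms in \<open>auto simp: orthonormal_basis_def\<close>)
  also have "Matrix.mat ?n ?n (\<lambda>(i, j). B ! i \<bullet> B ! j) = 1\<^sub>m ?n"
    by (rule eq_matI) (use assms in \<open>auto simp: orthonormal_basis_def\<close>)
  finally show ?thesis by (simp add: norm_eq_sqrt_inner)
qed

theorem
  fixes B vs :: "'a::euclidean_space list"
  assumes "length B = DIM('a)"
  shows multi_cross_in_power: "multi_cross B vs \<in> ext_power (DIM('a) - length vs)"
    and inner_multi_cross: "multi_cross B vs \<bullet> w = ext_wedge B \<bullet> (ext_wedge vs * w)"
proof -
  let ?P = "\<lambda>x. x \<in> ext_power (DIM('a) - length vs) \<and>
    (\<forall>w. x \<bullet> w = ext_wedge B \<bullet> (ext_wedge vs * w))"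
  let ?x = "\<Sum>m\<in>Basis. (ext_wedge B \<bullet> (ext_wedge vs * m)) *\<^sub>R m"
  have "(ext_wedge B \<bullet> (ext_wedge vs * m)) *\<^sub>R m \<in> ext_power (DIM('a) - length vs)"
    if m: "m \<in> Basis" for m
  proof -
    obtain S where S: "S \<subseteq> Basis" "m = ext_monom S" using m by (auto simp: Basis_exterior_def)
    obtain us r where us: "length us = card S" "m = r *\<^sub>R ext_wedge us"
      using ext_monom_wedge[OF S(1)] unfolding S(2)[symmetric] by blast
    show ?thesis
    proof (cases "length (vs @ us) = DIM('a)")
      case True
      then have "card S = DIM('a) - length vs" using us by auto
      then show ?thesis using ext_monom_in_power[OF S(1)] S(2)
        unfolding ext_power_def by (auto intro: span_mul)
    next
      case False
      then have "ext_wedge B \<bullet> (ext_wedge vs * m) = 0"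
        using inner_ext_wedge_degree[of B "vs @ us"] assms us by (simp add: ext_wedge_append)
      then show ?thesis unfolding ext_power_def by (simp add: span_zero)
    qed
  qed
  then have "?x \<in> ext_power (DIM('a) - length vs)"
    unfolding ext_power_def by (intro span_sum) auto
  moreover have "?x \<bullet> w = ext_wedge B \<bullet> (ext_wedge vs * w)" for w
  proof -
    have "ext_wedge B \<bullet> (ext_wedge vs * w)
        = ext_wedge B \<bullet> (ext_wedge vs * (\<Sum>m\<in>Basis. (w \<bullet> m) *\<^sub>R m))"
      by (simp add: euclidean_representation)
    also have "\<dots> = ?x \<bullet> w"
      by (simp add: sum_distrib_left inner_sum_right inner_sum_left inner_commute[of w] mult.commute)
    finally show ?thesis by simp
  qed
  ultimately have "?P ?x" by blast
  moreover have "y = ?x" if "?P y" for y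
    by (rule vector_eq_ldot[THEN iffD1]) (use that \<open>?P ?x\<close> in \<open>simp add: inner_commute\<close>)
  ultimately have "?P (multi_cross B vs)"
    unfolding multi_cross_def by (rule theI)
  then show "multi_cross B vs \<in> ext_power (DIM('a) - length vs)"
    and "multi_cross B vs \<bullet> w = ext_wedge B \<bullet> (ext_wedge vs * w)" by blast+
qed

lemma norm_multi_cross_Nil:
  assumes "orthonormal_basis B"
  shows "norm (multi_cross B []) = 1"
proof -
  have "multi_cross B [] = ext_wedge B"
    by (rule vector_eq_rdot[THEN iffD1])
      (use assms inner_multi_cross[of B "[]"] in \<open>simp add: orthonormal_basis_def\<close>)
  then show ?thesis using norm_ext_wedge_orthonormal[OF assms] by simp
qed


section \<open>Curves, Frenet-Serret frame and curvatures\<close>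

text \<open>The derivatives of a curve on \<open>[a, b]\<close> are one-sided at the end points.\<close>

primrec curve_deriv :: "real \<Rightarrow> real \<Rightarrow> (real \<Rightarrow> 'a::euclidean_space) \<Rightarrow> nat \<Rightarrow> real \<Rightarrow> 'a" where
  "curve_deriv a b c 0 = c"
| "curve_deriv a b c (Suc k) = (\<lambda>t. vector_derivative (curve_deriv a b c k) (at t within {a..b}))"

definition curve_derivs :: "real \<Rightarrow> real \<Rightarrow> (real \<Rightarrow> 'a::euclidean_space) \<Rightarrow> nat \<Rightarrow> real \<Rightarrow> 'a list"
  where "curve_derivs a b c k t = map (\<lambda>i. curve_deriv a b c i t) [1..<Suc k]"

text \<open>The highest derivative used below is the \<open>n\<close>-th one, where \<open>n = DIM('a)\<close>.\<close>

definition regular_curve :: "real \<Rightarrow> real \<Rightarrow> (real \<Rightarrow> 'a::euclidean_space) \<Rightarrow> bool"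
  where "regular_curve a b c \<longleftrightarrow> a < b \<and>
    (\<forall>k<DIM('a). curve_deriv a b c k differentiable_on {a..b}) \<and>
    (\<forall>t\<in>{a..b}. distinct (curve_derivs a b c (DIM('a) - 1) t) \<and>
       independent (set (curve_derivs a b c (DIM('a) - 1) t)))"

text \<open>Gram-Schmidt orthonormalization of \<open>v 1, v 2, \<dots>\<close>; \<^term>\<open>sgn x\<close> is \<open>x /\<^sub>R norm x\<close>.\<close>

fun gram_schmidt_vec :: "(nat \<Rightarrow> 'a::euclidean_space) \<Rightarrow> nat \<Rightarrow> 'a" where
  "gram_schmidt_vec v i =
    sgn (v i - (\<Sum>j\<in>{1..<i}. (v i \<bullet> gram_schmidt_vec v j) *\<^sub>R gram_schmidt_vec v j))"

declare gram_schmidt_vec.simps [simp del]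

definition frenet_vec ::
    "'a::euclidean_space list \<Rightarrow> real \<Rightarrow> real \<Rightarrow> (real \<Rightarrow> 'a) \<Rightarrow> nat \<Rightarrow> real \<Rightarrow> 'a"
  where "frenet_vec B a b c i t =
    (let e = gram_schmidt_vec (\<lambda>k. curve_deriv a b c k t)
     in if i < DIM('a) then e i
        else THE x. positive_orthonormal_basis B (map e [1..<DIM('a)] @ [x]))"

definition frenet_curvatures ::
    "'a::euclidean_space list \<Rightarrow> real \<Rightarrow> real \<Rightarrow> (real \<Rightarrow> 'a) \<Rightarrow> (nat \<Rightarrow> real \<Rightarrow> real) \<Rightarrow> bool"
  where "frenet_curvatures B a b c \<kappa> \<longleftrightarrow>
    (\<forall>t\<in>{a..b}. \<forall>i\<in>{1..DIM('a)}.
      (frenet_vec B a b c i has_vector_derivative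
        norm (curve_deriv a b c 1 t) *\<^sub>R
          ((if i = 1 then 0 else - \<kappa> (i - 1) t *\<^sub>R frenet_vec B a b c (i - 1) t) +
           (if i = DIM('a) then 0 else \<kappa> i t *\<^sub>R frenet_vec B a b c (i + 1) t)))
      (at t within {a..b}))"

end

theory Submission
  imports Defs
begin

text \<open>
  Differentiating \<open>c\<^sup>(\<^sup>r\<^sup>) \<bullet> e\<^sub>r\<^sub>+\<^sub>1 = 0\<close> and inserting the Frenet equation of \<open>e\<^sub>r\<^sub>+\<^sub>1\<close> gives
  \<open>\<parallel>c'\<parallel> \<kappa>\<^sub>r (c\<^sup>(\<^sup>r\<^sup>) \<bullet> e\<^sub>r) = c\<^sup>(\<^sup>r\<^sup>+\<^sup>1\<^sup>) \<bullet> e\<^sub>r\<^sub>+\<^sub>1\<close> for all \<open>1 \<le> r \<le> n - 1\<close>. On the other hand,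
  the derivatives of \<open>c\<close> are triangular with respect to the frame, so
  \<open>c' \<and> \<dots> \<and> c\<^sup>(\<^sup>k\<^sup>)\<close> is \<open>(\<Prod>i\<le>k. c\<^sup>(\<^sup>i\<^sup>) \<bullet> e\<^sub>i)\<close> times \<open>e\<^sub>1 \<and> \<dots> \<and> e\<^sub>k\<close>. Hence the norms of the cross
  products and the determinant are partial products of the numbers \<open>c\<^sup>(\<^sup>i\<^sup>) \<bullet> e\<^sub>i\<close>.
\<close>

section \<open>Orthonormal bases\<close>

text \<open>The frame is indexed by \<open>1..n\<close> and lists are indexed from 0; this is the
  bridge between the two conventions.\<close>

lemma orthonormal_basis_map_iff:
  fixes e :: "nat \<Rightarrow> 'a::euclidean_space"
  shows "orthonormal_basis (map e [1..<Suc DIM('a)]) \<longleftrightarrow>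
    (\<forall>i\<in>{1..DIM('a)}. \<forall>j\<in>{1..DIM('a)}. e i \<bullet> e j = (if i = j then 1 else 0))"
proof -
  have *: "(\<forall>i\<in>{1..DIM('a)}. P i) \<longleftrightarrow> (\<forall>i<DIM('a). P (Suc i))" for P
    by (metis One_nat_def Suc_le_eq atLeastAtMost_iff le_add1 not0_implies_Suc not_one_le_zero plus_1_eq_Suc)
  show ?thesis
    unfolding orthonormal_basis_def * by (simp del: upt_Suc)
qed

text \<open>Orthonormality makes \<open>B\<close> independent with \<open>DIM('a)\<close> elements,
  hence spanning. The difference of \<open>x\<close> and its expansion is orthogonal to every
  \<open>B ! i\<close>, hence to itself.\<close>

lemma orthonormal_basis_expansion:
  fixes B :: "'a::euclidean_space list"
  assumes "orthonormal_basis B"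
  shows "x = (\<Sum>i<DIM('a). (x \<bullet> B ! i) *\<^sub>R B ! i)"
proof -
  have B: "length B = DIM('a)"
    and o: "\<And>i j. i < DIM('a) \<Longrightarrow> j < DIM('a) \<Longrightarrow> B ! i \<bullet> B ! j = (if i = j then 1 else 0)"
    using assms by (auto simp: orthonormal_basis_def)
  have "distinct B"
    unfolding distinct_conv_nth using o B by (metis zero_neq_one)
  then have card: "card (set B) = DIM('a)"
    using B distinct_card by metis
  have "pairwise Linear_Algebra.orthogonal (set B)"
    by (auto simp: pairwise_def Linear_Algebra.orthogonal_def in_set_conv_nth o B)
  moreover have "0 \<notin> set B"
    using o B by (metis in_set_conv_nth inner_zero_left zero_neq_one)
  ultimately have "independent (set B)"
    by (intro pairwise_orthogonal_independent)
  then have span: "span (set B) = UNIV"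
    using card by (metis dim_eq_card_independent dim_eq_full)
  let ?y = "x - (\<Sum>i<DIM('a). (x \<bullet> B ! i) *\<^sub>R B ! i)"
  have "?y \<bullet> B ! j = 0" if "j < DIM('a)" for j
  proof -
    have "(\<Sum>i<DIM('a). (x \<bullet> B ! i) * (B ! i \<bullet> B ! j)) = (\<Sum>i<DIM('a). if i = j then x \<bullet> B ! i else 0)"
      by (intro sum.cong) (use o that in auto)
    then show ?thesis using that by (simp add: inner_diff_left inner_sum_left)
  qed
  then have "Linear_Algebra.orthogonal ?y z" if "z \<in> set B" for z
    using that B by (auto simp: Linear_Algebra.orthogonal_def in_set_conv_nth)
  then have "Linear_Algebra.orthogonal ?y ?y"
    by (intro orthogonal_to_span[of ?y "set B"]) (use span in auto)
  then show ?thesis by (simp add: Linear_Algebra.orthogonal_def)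
qed

lemma orthonormal_basis_map_expansion:
  fixes e :: "nat \<Rightarrow> 'a::euclidean_space"
  assumes "orthonormal_basis (map e [1..<Suc DIM('a)])"
  shows "x = (\<Sum>i = 1..DIM('a). (x \<bullet> e i) *\<^sub>R e i)"
proof -
  have "x = (\<Sum>i<DIM('a). (x \<bullet> e (Suc i)) *\<^sub>R e (Suc i))"
    by (subst orthonormal_basis_expansion[OF assms]) (intro sum.cong, auto simp del: upt_Suc)
  also have "\<dots> = (\<Sum>i = 1..DIM('a). (x \<bullet> e i) *\<^sub>R e i)"
    by (rule sum.reindex_bij_witness[where i = "\<lambda>i. i - 1" and j = Suc]) auto
  finally show ?thesis .
qed

text \<open>Lets every scaling of a wedge product pass to the determinant.\<close>

lemma coord_det_eq_inner:
  fixes B vs :: "'a::euclidean_space list"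
  assumes "length B = DIM('a)" "length vs = DIM('a)"
  shows "coord_det B vs = ext_wedge vs \<bullet> ext_wedge B"
  using inner_ext_wedge[OF assms(2,1)] by (simp add: coord_det_def)

text \<open>Expanding each \<open>E ! i\<close> along \<open>B\<close> shows that the coordinate
  matrix times its transpose is the identity.\<close>

lemma coord_det_orthonormal_basis:
  fixes B E :: "'a::euclidean_space list"
  assumes B: "orthonormal_basis B" and E: "orthonormal_basis E"
  shows "(coord_det B E)\<^sup>2 = 1"
proof -
  let ?n = "DIM('a)"
  let ?A = "Matrix.mat ?n ?n (\<lambda>(i, j). E ! i \<bullet> B ! j)"
  have "?A * transpose_mat ?A = 1\<^sub>m ?n"
  proof (rule eq_matI)
    fix i j assume "i < dim_row (1\<^sub>m ?n)" "j < dim_col (1\<^sub>m ?n)"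
    then have ij: "i < ?n" "j < ?n" by auto
    have "E ! i \<bullet> E ! j = (\<Sum>k<?n. (E ! i \<bullet> B ! k) *\<^sub>R B ! k) \<bullet> E ! j"
      using orthonormal_basis_expansion[OF B, of "E ! i"] by simp
    also have "\<dots> = (?A * transpose_mat ?A) $$ (i, j)"
      using ij by (simp add: inner_sum_left scalar_prod_def inner_commute[of "B ! _"] atLeast0LessThan)
    finally show "(?A * transpose_mat ?A) $$ (i, j) = 1\<^sub>m ?n $$ (i, j)"
      using E ij by (simp add: orthonormal_basis_def)
  qed auto
  then have "Determinant.det (?A * transpose_mat ?A) = 1" by simp
  then show ?thesis
    by (simp add: det_mult[of _ ?n] det_transpose[of _ ?n] coord_det_def power2_eq_square)
qed

section \<open>Wedge products\<close>

text \<open>Polarization: expand the vanishing square of \<open>ext_vec (u + v)\<close>.\<close>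

lemma ext_vec_anticommute: "ext_vec u * ext_vec v = - (ext_vec v * ext_vec u)"
proof -
  have "(ext_vec u + ext_vec v) * (ext_vec u + ext_vec v) = 0"
    by (metis ext_vec_square linear_add linear_ext_vec)
  then show ?thesis by (simp add: algebra_simps ext_vec_square eq_neg_iff_add_eq_0)
qed

lemma ext_wedge_mult_vec:
  "ext_wedge vs * ext_vec u = (-1) ^ length vs *\<^sub>R (ext_vec u * ext_wedge vs)"
proof (induction vs)
  case (Cons v vs)
  have "ext_vec v * (ext_vec u * ext_wedge vs) = - (ext_vec u * (ext_vec v * ext_wedge vs))"
    by (simp add: ext_vec_anticommute[of v u] flip: mult.assoc)
  then show ?case using Cons by (simp add: mult.assoc)
qed simp

lemma ext_wedge_mult_vec_eq_0:
  assumes "u \<in> set vs"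
  shows "ext_wedge vs * ext_vec u = 0"
  using assms
proof (induction vs)
  case (Cons v vs)
  show ?case
  proof (cases "u = v")
    case True
    have "ext_vec u * (ext_wedge vs * ext_vec u) = 0"
      by (simp add: ext_wedge_mult_vec ext_vec_square flip: mult.assoc)
    then show ?thesis using True by (simp add: mult.assoc)
  qed (use Cons in \<open>simp add: mult.assoc\<close>)
qed simp

text \<open>Induction on \<open>k\<close>: the components of the new vector along
  \<open>e 1, ..., e k\<close> are annihilated because these vectors already occur in the wedge
  product. Only the diagonal component survives.\<close>

lemma ext_wedge_triangular:
  assumes "\<And>i. i \<in> {1..k} \<Longrightarrow> v i = (\<Sum>j = 1..i. A i j *\<^sub>R e j)"
  shows "ext_wedge (map v [1..<Suc k]) = (\<Prod>i = 1..k. A i i) *\<^sub>R ext_wedge (map e [1..<Suc k])"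
  using assms
proof (induction k)
  case (Suc k)
  let ?W = "ext_wedge (map e [1..<Suc k])"
  have "?W * ext_vec (v (Suc k)) = (\<Sum>j = 1..Suc k. A (Suc k) j *\<^sub>R (?W * ext_vec (e j)))"
    using Suc.prems[of "Suc k"]
    by (simp add: linear_sum[OF linear_ext_vec] linear_cmul[OF linear_ext_vec] sum_distrib_left
        linear_add[OF linear_ext_vec] distrib_left
        del: upt_Suc)
  also have "\<dots> = A (Suc k) (Suc k) *\<^sub>R (?W * ext_vec (e (Suc k)))"
    by (simp add: ext_wedge_mult_vec_eq_0 del: upt_Suc)
  finally have *: "?W * ext_vec (v (Suc k)) = A (Suc k) (Suc k) *\<^sub>R (?W * ext_vec (e (Suc k)))" .
  have "[1..<Suc (Suc k)] = [1..<Suc k] @ [Suc k]" by simp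
  then show ?case using Suc * by (simp add: ext_wedge_append mult.commute del: upt_Suc)
qed simp

text \<open>Contraction by \<open>v\<close> is adjoint to multiplication by \<open>v\<close>, and
  the rule for contracting \<open>ext_vec v * x\<close> yields a Pythagorean identity: the squared
  norms of the product and of the contraction of \<open>x\<close> add up to
  \<open>(norm v * norm x)\<close> squared.\<close>

lemma norm_ext_vec_mult_le: "norm (ext_vec v * x) \<le> norm v * norm x"
proof (rule power2_le_imp_le)
  have "(norm (ext_vec v * x))\<^sup>2 = (norm v * norm x)\<^sup>2 - (norm (ext_contract v x))\<^sup>2"
    by (simp add: power2_norm_eq_inner inner_vec_mult ext_contract_vec_mult inner_diff_right
        inner_commute[of x "ext_vec v * _"] power_mult_distrib)
  then show "(norm (ext_vec v * x))\<^sup>2 \<le> (norm v * norm x)\<^sup>2" by simp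
qed simp

lemma norm_ext_wedge_mult_le:
  assumes "\<And>v. v \<in> set vs \<Longrightarrow> norm v = 1"
  shows "norm (ext_wedge vs * x) \<le> norm x"
  using assms
proof (induction vs)
  case (Cons v vs)
  have "norm (ext_wedge (v # vs) * x) \<le> norm v * norm (ext_wedge vs * x)"
    using norm_ext_vec_mult_le by (simp add: mult.assoc)
  then show ?case using Cons by force
qed simp

section \<open>Norms of multiple cross products\<close>

text \<open>A cross product is determined by its inner products with all \<open>w\<close>, and these
  depend on \<open>vs\<close> only through \<open>ext_wedge vs\<close>.\<close>

lemma multi_cross_scale:
  fixes B us vs :: "'a::euclidean_space list"
  assumes "length B = DIM('a)" "ext_wedge vs = r *\<^sub>R ext_wedge us"
  shows "multi_cross B vs = r *\<^sub>R multi_cross B us"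
  by (rule vector_eq_rdot[THEN iffD1]) (use assms in \<open>simp add: inner_multi_cross\<close>)

text \<open>Two bounds replace an explicit formula: pairing the cross product with itself bounds its
  norm above, pairing it with the wedge of the complementary vectors \<open>ws\<close> bounds it
  below.\<close>

lemma norm_multi_cross_orthonormal:
  fixes B us ws :: "'a::euclidean_space list"
  assumes B: "orthonormal_basis B" and E: "orthonormal_basis (us @ ws)"
  shows "norm (multi_cross B us) = 1"
proof (rule antisym)
  let ?x = "multi_cross B us"
  have lB: "length B = DIM('a)" and lE: "length (us @ ws) = DIM('a)"
    using assms by (auto simp: orthonormal_basis_def)
  have unit: "norm v = 1" if v: "v \<in> set (us @ ws)" for v
  proof -
    obtain i where "i < length (us @ ws)" "v = (us @ ws) ! i"
      using v by (metis in_set_conv_nth)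
    then show ?thesis
      using E lE by (auto simp: orthonormal_basis_def norm_eq_sqrt_inner)
  qed
  \<comment> \<open>Wedging with unit vectors does not increase norms, so the squared norm of
    \<open>?x\<close> is at most its norm.\<close>
  have "(norm ?x)\<^sup>2 = ext_wedge B \<bullet> (ext_wedge us * ?x)"
    by (simp add: power2_norm_eq_inner inner_multi_cross[OF lB])
  also have "\<dots> \<le> norm (ext_wedge B) * norm (ext_wedge us * ?x)"
    by (rule norm_cauchy_schwarz)
  also have "\<dots> \<le> norm ?x"
    using norm_ext_wedge_mult_le[of us ?x] unit by (simp add: norm_ext_wedge_orthonormal[OF B])
  finally show "norm ?x \<le> 1"
    by (cases "norm ?x = 0") (auto simp: power2_eq_square)
  \<comment> \<open>This pairing is the determinant of an orthonormal basis, known only up to sign,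
    hence the squares.\<close>
  have "(?x \<bullet> ext_wedge ws)\<^sup>2 = (coord_det B (us @ ws))\<^sup>2"
    by (simp add: inner_multi_cross[OF lB] coord_det_eq_inner[OF lB lE] ext_wedge_append inner_commute[of "ext_wedge B"])
  then have "\<bar>?x \<bullet> ext_wedge ws\<bar> = 1"
    using coord_det_orthonormal_basis[OF B E] by (auto simp: power2_eq_1_iff)
  moreover have "norm (ext_wedge ws) \<le> 1"
  proof -
    have "ext_wedge ([] :: 'a list) \<bullet> ext_wedge ([] :: 'a list) = 1"
      by (subst inner_ext_wedge[of _ 0]) (auto simp: Determinant.det_def)
    then have "norm (1 :: 'a exterior) = 1" by (simp add: norm_eq_sqrt_inner)
    then show ?thesis using norm_ext_wedge_mult_le[of ws 1] unit by simp
  qed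
  ultimately show "1 \<le> norm ?x"
    using Cauchy_Schwarz_ineq2[of ?x "ext_wedge ws"]
      mult_left_le[of "norm (ext_wedge ws)" "norm ?x"] by simp
qed

text \<open>Reduces to the first \<open>k\<close> frame vectors, with the remaining ones as
  complement. The case \<open>k = 0\<close> yields the conventional norm 1 of the empty cross
  product.\<close>

lemma norm_multi_cross_triangular:
  fixes B :: "'a::euclidean_space list"
  assumes B: "orthonormal_basis B" and E: "orthonormal_basis (map e [1..<Suc DIM('a)])"
    and "k \<le> DIM('a)"
    and "\<And>i. i \<in> {1..k} \<Longrightarrow> v i = (\<Sum>j = 1..i. A i j *\<^sub>R e j)"
  shows "norm (multi_cross B (map v [1..<Suc k])) = \<bar>\<Prod>i = 1..k. A i i\<bar>"
proof -
  have "[1..<Suc DIM('a)] = [1..<Suc k] @ [Suc k..<Suc DIM('a)]"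
    using upt_add_eq_append[of 1 "Suc k" "DIM('a) - k"] \<open>k \<le> DIM('a)\<close> by (simp del: upt_Suc)
  then have "orthonormal_basis (map e [1..<Suc k] @ map e [Suc k..<Suc DIM('a)])"
    using E by (simp only: map_append)
  then have "norm (multi_cross B (map e [1..<Suc k])) = 1"
    by (rule norm_multi_cross_orthonormal[OF B])
  moreover have "length B = DIM('a)"
    using B by (simp add: orthonormal_basis_def)
  ultimately show ?thesis
    using multi_cross_scale[OF _ ext_wedge_triangular[OF assms(4)]] by (simp del: upt_Suc)
qed

section \<open>The Frenet-Serret frame\<close>

lemma gram_schmidt_vec:
  fixes v :: "nat \<Rightarrow> 'a::euclidean_space"
  assumes v: "\<forall>i\<in>{1..m}. v i \<notin> span (v ` {1..<i})"
  shows gram_schmidt_vec_orthonormal: "i \<in> {1..m} \<Longrightarrow> j \<in> {1..m} \<Longrightarrow>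
      gram_schmidt_vec v i \<bullet> gram_schmidt_vec v j = (if i = j then 1 else 0)"
    and gram_schmidt_vec_expansion: "i \<in> {1..m} \<Longrightarrow>
      v i = (\<Sum>j = 1..i. (v i \<bullet> gram_schmidt_vec v j) *\<^sub>R gram_schmidt_vec v j)"
    and gram_schmidt_vec_inner_pos: "i \<in> {1..m} \<Longrightarrow> v i \<bullet> gram_schmidt_vec v i > 0"
proof -
  let ?e = "gram_schmidt_vec v"
  \<comment> \<open>The vector before normalization; its norm turns out to be the diagonal
    coefficient of \<open>v i\<close>.\<close>
  define w where "w i = v i - (\<Sum>j\<in>{1..<i}. (v i \<bullet> ?e j) *\<^sub>R ?e j)" for i
  have e: "?e i = sgn (w i)" for i
    by (simp add: gram_schmidt_vec.simps[of v i] w_def)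
  \<comment> \<open>The three claims are proved together: \<open>w i\<close> is nonzero because the
    earlier \<open>?e j\<close> stay in the span of the earlier \<open>v j\<close>, and it is
    orthogonal to them because they are already orthonormal.\<close>
  have *: "w i \<noteq> 0 \<and> (\<forall>j\<in>{1..<i}. w i \<bullet> ?e j = 0) \<and> ?e i \<in> span (v ` {1..i})"
    if "i \<in> {1..m}" for i
    using that
  proof (induction i rule: less_induct)
    case (less i)
    have IH: "w j \<noteq> 0" "?e j \<in> span (v ` {1..j})" "\<forall>l\<in>{1..<j}. ?e j \<bullet> ?e l = 0" if "j \<in> {1..<i}" for j
    proof -
      have "w j \<noteq> 0 \<and> (\<forall>l\<in>{1..<j}. w j \<bullet> ?e l = 0) \<and> ?e j \<in> span (v ` {1..j})"
        by (rule less.IH) (use that less.prems in auto)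
      then show "w j \<noteq> 0" "?e j \<in> span (v ` {1..j})" "\<forall>l\<in>{1..<j}. ?e j \<bullet> ?e l = 0"
        by (auto simp: e[of j] sgn_div_norm)
    qed
    have orth: "?e l \<bullet> ?e j = (if l = j then 1 else 0)" if "j \<in> {1..<i}" "l \<in> {1..<i}" for j l
    proof (cases l j rule: linorder_cases)
      case less
      then show ?thesis using IH(3)[of j] that by (auto simp: inner_commute)
    next
      case equal
      then show ?thesis using IH(1)[of j] that by (simp add: e norm_sgn flip: power2_norm_eq_inner)
    next
      case greater
      then show ?thesis using IH(3)[of l] that by auto
    qed
    have "?e j \<in> span (v ` {1..<i})" if "j \<in> {1..<i}" for j
      by (rule subsetD[OF span_mono IH(2)]) (use that in auto)
    then have S: "(\<Sum>j\<in>{1..<i}. (v i \<bullet> ?e j) *\<^sub>R ?e j) \<in> span (v ` {1..<i})"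
      by (intro span_sum span_mul)
    then have "w i \<noteq> 0"
      using v less.prems by (auto simp: w_def)
    moreover have "w i \<bullet> ?e j = 0" if "j \<in> {1..<i}" for j
    proof -
      have "(\<Sum>l\<in>{1..<i}. (v i \<bullet> ?e l) * (?e l \<bullet> ?e j)) = (\<Sum>l\<in>{1..<i}. if l = j then v i \<bullet> ?e l else 0)"
        by (intro sum.cong) (use orth that in auto)
      then show ?thesis using that by (simp add: w_def inner_diff_left inner_sum_left)
    qed
    moreover have "?e i \<in> span (v ` {1..i})"
    proof -
      have "(\<Sum>j\<in>{1..<i}. (v i \<bullet> ?e j) *\<^sub>R ?e j) \<in> span (v ` {1..i})"
        by (rule subsetD[OF span_mono S]) auto
      then have "w i \<in> span (v ` {1..i})"
        unfolding w_def using less.prems by (intro span_diff) (auto intro: span_base)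
      then show ?thesis by (simp add: e sgn_div_norm span_mul)
    qed
    ultimately show ?case by blast
  qed
  have lower: "?e i \<bullet> ?e j = 0" if "i \<in> {1..m}" "j \<in> {1..<i}" for i j
    using *[OF that(1)] that(2) by (simp add: e[of i] sgn_div_norm)
  have unit: "?e i \<bullet> ?e i = 1" if "i \<in> {1..m}" for i
    using *[OF that] by (simp add: e norm_sgn flip: power2_norm_eq_inner)
  show "?e i \<bullet> ?e j = (if i = j then 1 else 0)" if "i \<in> {1..m}" "j \<in> {1..m}" for i j
    using lower[of i j] lower[of j i] unit[of i] that
    by (cases i j rule: linorder_cases) (auto simp: inner_commute)
  have decomp: "v i = norm (w i) *\<^sub>R ?e i + (\<Sum>j\<in>{1..<i}. (v i \<bullet> ?e j) *\<^sub>R ?e j)" if "i \<in> {1..m}" for i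
    using *[OF that] by (simp add: e[of i] sgn_div_norm w_def)
  have inner: "v i \<bullet> ?e i = norm (w i)" if "i \<in> {1..m}" for i
  proof -
    have "(\<Sum>j\<in>{1..<i}. (v i \<bullet> ?e j) *\<^sub>R ?e j) \<bullet> ?e i = 0"
      unfolding inner_sum_left by (rule sum.neutral) (use lower[OF that] in \<open>simp add: inner_commute[of "?e _" "?e i"]\<close>)
    then show ?thesis
      by (subst decomp[OF that]) (simp add: inner_add_left unit[OF that])
  qed
  show "v i \<bullet> ?e i > 0" if "i \<in> {1..m}" for i
    using *[OF that] inner[OF that] by simp
  show "v i = (\<Sum>j = 1..i. (v i \<bullet> ?e j) *\<^sub>R ?e j)" if i: "i \<in> {1..m}" for i
  proof -
    have "{1..i} = insert i {1..<i}" using i by auto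
    then show ?thesis using decomp[OF i] inner[OF i] by simp
  qed
qed

text \<open>Makes the \<open>THE\<close> in \<open>frenet_vec\<close> meaningful. A unit vector
  orthogonal to the given ones exists by dimension, and its sign can be adjusted because the
  determinant is linear in the last vector.\<close>

lemma ex1_positive_completion:
  fixes B :: "'a::euclidean_space list"
  assumes B: "orthonormal_basis B"
    and e: "\<And>i j. i \<in> {1..<DIM('a)} \<Longrightarrow> j \<in> {1..<DIM('a)} \<Longrightarrow> e i \<bullet> e j = (if i = j then 1 else 0)"
  shows "\<exists>!x. positive_orthonormal_basis B (map e [1..<DIM('a)] @ [x])"
proof -
  let ?E = "map e [1..<DIM('a)]"
  have lB: "length B = DIM('a)" using B by (simp add: orthonormal_basis_def)
  have upd: "?E @ [x] = map (e(DIM('a) := x)) [1..<Suc DIM('a)]" for x by simp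
  have iff: "orthonormal_basis (?E @ [x]) \<longleftrightarrow> x \<bullet> x = 1 \<and> (\<forall>i\<in>{1..<DIM('a)}. x \<bullet> e i = 0)" for x
  proof -
    have "{1..DIM('a)} = insert DIM('a) {1..<DIM('a)}" by auto
    then show ?thesis
      unfolding upd orthonormal_basis_map_iff using e by (auto simp: inner_commute)
  qed
  have scale: "coord_det B (?E @ [r *\<^sub>R x]) = r * coord_det B (?E @ [x])" for r x
    by (simp add: coord_det_eq_inner[OF lB] ext_wedge_append linear_cmul[OF linear_ext_vec])
  have "dim (e ` {1..<DIM('a)}) \<le> card (e ` {1..<DIM('a)})"
    by (intro dim_le_card span_superset) auto
  also have "\<dots> \<le> DIM('a) - 1"
    using card_image_le[of "{1..<DIM('a)}" e] by simp
  finally have "dim (e ` {1..<DIM('a)}) < DIM('a)"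
    using DIM_positive[where 'a = 'a] by linarith
  then obtain x where x: "x \<noteq> 0" "\<And>y. y \<in> span (e ` {1..<DIM('a)}) \<Longrightarrow> Linear_Algebra.orthogonal x y"
    by (rule orthogonal_to_subspace_exists) blast
  have ob: "orthonormal_basis (?E @ [sgn x])"
    unfolding iff using x
    by (auto simp: norm_sgn sgn_div_norm[of x] Linear_Algebra.orthogonal_def span_base simp flip: power2_norm_eq_inner)
  \<comment> \<open>Since \<open>g\<close> is 1 or -1, scaling the last vector by \<open>g\<close>
    turns the determinant \<open>g\<close> into \<open>g * g = 1\<close>.\<close>
  define g where "g = coord_det B (?E @ [sgn x])"
  have g: "g * g = 1"
    using coord_det_orthonormal_basis[OF B ob] by (simp add: g_def power2_eq_square)
  have "positive_orthonormal_basis B (?E @ [g *\<^sub>R sgn x])"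
    using ob g unfolding positive_orthonormal_basis_def scale g_def[symmetric] iff
    by (auto simp flip: mult.assoc)
  moreover have "y = z"
    if y: "positive_orthonormal_basis B (?E @ [y])" and z: "positive_orthonormal_basis B (?E @ [z])" for y z
  proof -
    \<comment> \<open>Expand one completion in the basis completed by the other: only the last
      coefficient \<open>z \<bullet> y\<close> survives. Positivity of both determinants and unit
      length force it to be 1.\<close>
    have "z = (\<Sum>i = 1..DIM('a). (z \<bullet> (e(DIM('a) := y)) i) *\<^sub>R (e(DIM('a) := y)) i)"
      using y unfolding positive_orthonormal_basis_def upd
      by (intro orthonormal_basis_map_expansion) (rule conjunct1)
    also have "\<dots> = (\<Sum>i = 1..DIM('a). if i = DIM('a) then (z \<bullet> y) *\<^sub>R y else 0)"
      by (rule sum.cong) (use z[unfolded positive_orthonormal_basis_def iff] in auto)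
    finally have zy: "z = (z \<bullet> y) *\<^sub>R y"
      using DIM_positive[where 'a = 'a] by (simp add: Suc_le_eq)
    have "z \<bullet> y > 0"
      using scale[of "z \<bullet> y" y] y z by (simp add: positive_orthonormal_basis_def zero_less_mult_iff flip: zy)
    moreover have "(z \<bullet> y)\<^sup>2 = 1"
      using z zy by (metis inner_commute inner_scaleR_left iff positive_orthonormal_basis_def power2_eq_square)
    ultimately have "z \<bullet> y = 1" by (simp add: power2_eq_1_iff)
    then show "y = z" using zy by simp
  qed
  ultimately show ?thesis by blast
qed

text \<open>Positivity of the diagonal coefficients stops before \<open>i = n\<close>: the
  coefficient of the \<open>n\<close>-th derivative along the last frame vector can have either
  sign, and it carries the sign of the torsion.\<close>

lemma frenet_frame:
  fixes c :: "real \<Rightarrow> 'a::euclidean_space"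
  assumes B: "orthonormal_basis B" and c: "regular_curve a b c" and t: "t \<in> {a..b}"
  defines "e \<equiv> \<lambda>i. frenet_vec B a b c i t" and "v \<equiv> \<lambda>i. curve_deriv a b c i t"
  shows positive_frenet_frame: "positive_orthonormal_basis B (map e [1..<Suc DIM('a)])"
    and frenet_expansion: "\<And>i. i \<in> {1..DIM('a)} \<Longrightarrow> v i = (\<Sum>j = 1..i. (v i \<bullet> e j) *\<^sub>R e j)"
    and frenet_inner_pos: "\<And>i. i \<in> {1..<DIM('a)} \<Longrightarrow> v i \<bullet> e i > 0"
proof -
  let ?m = "DIM('a) - 1"
  let ?g = "gram_schmidt_vec v"
  have m: "{1..?m} = {1..<DIM('a)}" by auto
  have d: "distinct (map v [1..<Suc ?m])" and ind: "independent (v ` {1..?m})"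
    using c t unfolding regular_curve_def curve_derivs_def v_def
    by (simp_all add: m del: upt_Suc One_nat_def)
  have v: "\<forall>i\<in>{1..?m}. v i \<notin> span (v ` {1..<i})"
  proof
    fix i assume i: "i \<in> {1..?m}"
    \<comment> \<open>Independence of a set does not see repetitions in a list; distinctness
      excludes them.\<close>
    have "inj_on v {1..?m}"
      using d by (simp add: distinct_map m del: upt_Suc One_nat_def)
    then have "v i \<notin> v ` {1..<i}"
      using i by (auto dest!: inj_onD)
    moreover have "independent (insert (v i) (v ` {1..<i}))"
      by (rule independent_mono[OF ind]) (use i in auto)
    ultimately show "v i \<notin> span (v ` {1..<i})" by (simp add: independent_insert)
  qed
  note gs = gram_schmidt_vec[OF v, unfolded m]
  have e: "e i = ?g i" if "i < DIM('a)" for i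
    using that by (simp add: e_def v_def frenet_vec_def)
  have "e DIM('a) = (THE x. positive_orthonormal_basis B (map ?g [1..<DIM('a)] @ [x]))"
    by (simp add: e_def v_def frenet_vec_def)
  then have "positive_orthonormal_basis B (map ?g [1..<DIM('a)] @ [e DIM('a)])"
    using theI'[OF ex1_positive_completion[OF B gs(1)]] by simp
  moreover have "map e [1..<Suc DIM('a)] = map ?g [1..<DIM('a)] @ [e DIM('a)]"
    using e by auto
  ultimately show pos: "positive_orthonormal_basis B (map e [1..<Suc DIM('a)])"
    by (simp only:)
  show "v i \<bullet> e i > 0" if "i \<in> {1..<DIM('a)}" for i
    using gs(3)[OF that] e that by simp
  show "v i = (\<Sum>j = 1..i. (v i \<bullet> e j) *\<^sub>R e j)" if "i \<in> {1..DIM('a)}" for i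
  proof (cases "i = DIM('a)")
    \<comment> \<open>The last derivative is outside the Gram-Schmidt process; its triangular
      expansion is the expansion in the full basis.\<close>
    case True
    then show ?thesis
      using orthonormal_basis_map_expansion[of e "v i"] pos by (simp add: positive_orthonormal_basis_def)
  next
    case False
    then have i: "i \<in> {1..<DIM('a)}" using that by auto
    have "v i = (\<Sum>j = 1..i. (v i \<bullet> ?g j) *\<^sub>R ?g j)" by (rule gs(2)[OF i])
    also have "\<dots> = (\<Sum>j = 1..i. (v i \<bullet> e j) *\<^sub>R e j)"
      by (intro sum.cong) (use i e in auto)
    finally show ?thesis .
  qed
qed

lemma frenet_inner:
  fixes c :: "real \<Rightarrow> 'a::euclidean_space"
  assumes "orthonormal_basis B" "regular_curve a b c" "t \<in> {a..b}"
    and "i \<in> {1..DIM('a)}" "j \<in> {1..DIM('a)}"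
  shows "frenet_vec B a b c i t \<bullet> frenet_vec B a b c j t = (if i = j then 1 else 0)"
  using positive_frenet_frame[OF assms(1-3)] assms(4,5)
  unfolding positive_orthonormal_basis_def orthonormal_basis_map_iff by blast

section \<open>Curvatures from the derivatives and the frame\<close>

lemma curve_deriv_inner_frenet_eq_0:
  fixes c :: "real \<Rightarrow> 'a::euclidean_space"
  assumes "orthonormal_basis B" "regular_curve a b c" "t \<in> {a..b}"
    and "1 \<le> i" "i < j" "j \<le> DIM('a)"
  shows "curve_deriv a b c i t \<bullet> frenet_vec B a b c j t = 0"
proof -
  have "i \<in> {1..DIM('a)}" using assms by auto
  note frenet_expansion[OF assms(1-3) this]
  moreover have "(\<Sum>l = 1..i. (curve_deriv a b c i t \<bullet> frenet_vec B a b c l t) *\<^sub>R frenet_vec B a b c l t)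
      \<bullet> frenet_vec B a b c j t = 0"
    unfolding inner_sum_left
    by (rule sum.neutral) (use assms in \<open>simp add: frenet_inner[OF assms(1-3)]\<close>)
  ultimately show ?thesis by metis
qed

lemma curvature_eq:
  fixes c :: "real \<Rightarrow> 'a::euclidean_space"
  assumes B: "orthonormal_basis B" and c: "regular_curve a b c"
    and \<kappa>: "frenet_curvatures B a b c \<kappa>" and t: "t \<in> {a..b}"
    and r: "1 \<le> r" "r < DIM('a)"
  shows "norm (curve_deriv a b c 1 t) * \<kappa> r t * (curve_deriv a b c r t \<bullet> frenet_vec B a b c r t)
    = curve_deriv a b c (Suc r) t \<bullet> frenet_vec B a b c (Suc r) t"
proof -
  let ?v = "curve_deriv a b c" and ?e = "frenet_vec B a b c"
  \<comment> \<open>The right-hand side of the Frenet equation for index \<open>Suc r\<close>. The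
    conditional drops the term along the nonexistent vector with index \<open>n + 1\<close>, so the
    torsion is treated together with the other curvatures.\<close>
  let ?d = "norm (?v 1 t) *\<^sub>R (- \<kappa> r t *\<^sub>R ?e r t
      + (if Suc r = DIM('a) then 0 else \<kappa> (Suc r) t *\<^sub>R ?e (Suc (Suc r)) t))"
  have "a < b" and diff: "?v r differentiable_on {a..b}"
    using c r by (auto simp: regular_curve_def)
  have dv: "(?v r has_vector_derivative ?v (Suc r) t) (at t within {a..b})"
    using diff t by (simp add: differentiable_on_def vector_derivative_works)
  have de: "(?e (Suc r) has_vector_derivative ?d) (at t within {a..b})"
  proof -
    have "Suc r \<in> {1..DIM('a)}" and *: "(Suc r = 1) = False" using r by auto
    then show ?thesis
      using \<kappa>[unfolded frenet_curvatures_def, rule_format, OF t, of "Suc r"]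
      by (simp only: * if_False diff_Suc_1 Suc_eq_plus1[symmetric])
  qed
  have "((\<lambda>s. ?v r s \<bullet> ?e (Suc r) s) has_vector_derivative
      (?v r t \<bullet> ?d + ?v (Suc r) t \<bullet> ?e (Suc r) t)) (at t within {a..b})"
    using has_derivative_inner[OF dv[unfolded has_vector_derivative_def] de[unfolded has_vector_derivative_def]]
    by (simp add: has_vector_derivative_def algebra_simps)
  \<comment> \<open>The inner product vanishes on all of \<open>{a..b}\<close>, so its derivative
    within the interval is 0 at the end points as well.\<close>
  moreover have "((\<lambda>s. ?v r s \<bullet> ?e (Suc r) s) has_vector_derivative 0) (at t within {a..b})"
    by (rule has_vector_derivative_transform[OF t _ has_vector_derivative_const])
      (use r curve_deriv_inner_frenet_eq_0[OF B c] in auto)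
  ultimately have "?v r t \<bullet> ?d + ?v (Suc r) t \<bullet> ?e (Suc r) t = 0"
    using t
    by (intro vector_derivative_unique_within_closed_interval[OF \<open>a < b\<close>, of t]) (simp_all only: box_real)
  moreover have "?v r t \<bullet> ?e (Suc (Suc r)) t = 0" if "Suc r \<noteq> DIM('a)"
    by (rule curve_deriv_inner_frenet_eq_0[OF B c t]) (use r that in auto)
  ultimately show ?thesis
    by (auto simp: inner_diff_right algebra_simps split: if_splits)
qed

section \<open>The curvature and torsion formulas\<close>

theorem corollary2:
  fixes c :: "real \<Rightarrow> 'a::euclidean_space" and B :: "'a list"
    and a b t :: real and \<kappa> :: "nat \<Rightarrow> real \<Rightarrow> real"
  assumes "DIM('a) \<ge> 2"
    and "orthonormal_basis B"
    and "regular_curve a b c"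
    and "frenet_curvatures B a b c \<kappa>"
    and "t \<in> {a..b}"
  shows "(\<forall>r. 1 \<le> r \<and> r \<le> DIM('a) - 2 \<longrightarrow>
      \<kappa> r t = norm (multi_cross B (curve_derivs a b c (r - 1) t))
              * norm (multi_cross B (curve_derivs a b c (r + 1) t))
              / (norm (multi_cross B (curve_derivs a b c r t)))\<^sup>2
              * inverse (norm (curve_deriv a b c 1 t)))
    \<and> \<kappa> (DIM('a) - 1) t = norm (multi_cross B (curve_derivs a b c (DIM('a) - 2) t))
              / (norm (multi_cross B (curve_derivs a b c (DIM('a) - 1) t)))\<^sup>2
              * coord_det B (curve_derivs a b c (DIM('a)) t)
              * inverse (norm (curve_deriv a b c 1 t))"
proof -
  note B = assms(2) and c = assms(3) and t = assms(5)
  let ?n = "DIM('a)"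
  define v where "v i = curve_deriv a b c i t" for i
  define e where "e i = frenet_vec B a b c i t" for i
  define P where "P k = (\<Prod>i = 1..k. v i \<bullet> e i)" for k
  have pob: "positive_orthonormal_basis B (map e [1..<Suc ?n])"
    unfolding e_def by (rule positive_frenet_frame[OF B c t])
  then have ob: "orthonormal_basis (map e [1..<Suc ?n])"
    by (simp add: positive_orthonormal_basis_def)
  have tri: "v i = (\<Sum>j = 1..i. (v i \<bullet> e j) *\<^sub>R e j)" if "i \<in> {1..?n}" for i
    using frenet_expansion[OF B c t that] by (simp add: v_def e_def)
  have pos: "v i \<bullet> e i > 0" if "i \<in> {1..<?n}" for i
    using frenet_inner_pos[OF B c t that] by (simp add: v_def e_def)
  have derivs: "curve_derivs a b c k t = map v [1..<Suc k]" for k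
    by (simp add: curve_derivs_def v_def)
  have P_pos: "P k > 0" if "k < ?n" for k
    unfolding P_def by (rule prod_pos) (use that pos in auto)
  have P_Suc: "P (Suc k) = P k * (v (Suc k) \<bullet> e (Suc k))" for k
    by (simp add: P_def)
  \<comment> \<open>For \<open>k < n\<close> all factors are positive and the absolute value
    disappears. \<open>P n\<close> may be negative; it enters through the determinant, which keeps
    the sign.\<close>
  have norm_P: "norm (multi_cross B (curve_derivs a b c k t)) = P k" if "k < ?n" for k
  proof -
    have "norm (multi_cross B (curve_derivs a b c k t)) = \<bar>P k\<bar>"
      unfolding derivs P_def by (rule norm_multi_cross_triangular[OF B ob]) (use that tri in auto)
    then show ?thesis using P_pos[OF that] by simp
  qed
  have det_P: "coord_det B (curve_derivs a b c ?n t) = P ?n"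
  proof -
    have "coord_det B (map e [1..<Suc ?n]) = 1"
      using coord_det_orthonormal_basis[OF B ob] pob
      by (simp add: power2_eq_1_iff positive_orthonormal_basis_def del: upt_Suc)
    moreover have "coord_det B (map v [1..<Suc ?n]) = P ?n * coord_det B (map e [1..<Suc ?n])"
      using B ext_wedge_triangular[of ?n v "\<lambda>i j. v i \<bullet> e j" e, OF tri]
      by (simp add: coord_det_eq_inner orthonormal_basis_def P_def del: upt_Suc)
    ultimately show ?thesis by (simp add: derivs)
  qed
  have v1: "norm (v 1) > 0"
    using pos[of 1] assms(1) by auto
  \<comment> \<open>The quotient of the three products collapses to the ratio of the diagonal
    coefficients with indices \<open>Suc r\<close> and \<open>r\<close>. The range includes
    \<open>r = n - 1\<close>, where \<open>P (Suc r)\<close> is the determinant.\<close>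
  have main: "\<kappa> r t = P (r - 1) * P (Suc r) / (P r)\<^sup>2 * inverse (norm (v 1))" if r: "1 \<le> r" "r < ?n" for r
  proof -
    have "norm (v 1) * \<kappa> r t * (v r \<bullet> e r) = v (Suc r) \<bullet> e (Suc r)"
      using curvature_eq[OF B c assms(4) t r] by (simp add: v_def e_def)
    moreover have "P r = P (r - 1) * (v r \<bullet> e r)"
      using P_Suc[of "r - 1"] r by simp
    moreover have "P (r - 1) > 0" "v r \<bullet> e r > 0"
      using P_pos[of "r - 1"] pos[of r] r by auto
    ultimately show ?thesis
      using v1 by (simp add: P_Suc field_simps power2_eq_square)
  qed
  show ?thesis
  proof (intro conjI allI impI)
    fix r assume "1 \<le> r \<and> r \<le> ?n - 2"
    then have "1 \<le> r" "r < ?n" "r - 1 < ?n" "r + 1 < ?n" using assms(1) by auto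
    then show "\<kappa> r t = norm (multi_cross B (curve_derivs a b c (r - 1) t))
              * norm (multi_cross B (curve_derivs a b c (r + 1) t))
              / (norm (multi_cross B (curve_derivs a b c r t)))\<^sup>2
              * inverse (norm (curve_deriv a b c 1 t))"
      using main[of r] by (simp add: norm_P v_def)
  next
    \<comment> \<open>For \<open>n = 2\<close> the index \<open>n - 2\<close> is 0 and belongs to
      the empty cross product, whose norm \<open>P 0\<close> is 1.\<close>
    have "?n - 1 - 1 = ?n - 2" "Suc (?n - 1) = ?n" "1 \<le> ?n - 1" "?n - 1 < ?n" "?n - 2 < ?n"
      using assms(1) by auto
    then show "\<kappa> (?n - 1) t = norm (multi_cross B (curve_derivs a b c (?n - 2) t))
              / (norm (multi_cross B (curve_derivs a b c (?n - 1) t)))\<^sup>2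
              * coord_det B (curve_derivs a b c ?n t)
              * inverse (norm (curve_deriv a b c 1 t))"
      using main[of "?n - 1"] by (simp add: norm_P det_P v_def)
  qed
qed

end
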